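(* Let $a\in\mathbb{R}^d$ with $\|a\|_{l_1^d}=1$, let $c_0,c_1>0$, and let $g\colon[-1,1]\to\mathbb{R}$ be a differentiable function such that $|g(t_1)-g(t_2)|\le c_0|t_1-t_2|$ and $|g'(t_1)-g'(t_2)|\le c_1|t_1-t_2|$ for all $t_1,t_2\in[-1,1]$, and $g'(0)>0$. Let $f\colon[-1,1]^d\to\mathbb{R}$ be given by $f(x)=g(\langle a,x\rangle)$. Let $0<h\le 1$ and put $$\tilde a_i:=\frac{f(he_i)-f(0)}{h}\quad(i=1,\dots,d),\qquad \hat a:=\frac{\tilde a}{\|\tilde a\|_{l_1^d}},$$ $$\hat g(t):=f\big(t\cdot\mathrm{sign}(\hat a)\big)\quad(t\in[-1,1]),\qquad \hat f(x):=\hat g(\langle\hat a,x\rangle)\quad(x\in[-1,1]^d).$$ If $\tilde a\neq 0$ (so that $\hat a$ is defined), then $$\|f-\hat f\|_\infty\le 2c_0\|\hat a-a\|_{l_1^d}.$$ If $g'(0)-c_1h>0$, then moreover $\hat a$ is defined and $$2c_0\|\hat a-a\|_{l_1^d}\le\frac{4c_0c_1h}{g'(0)-c_1h}.$$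
   Context: $e_1,\dots,e_d$ are the canonical basis vectors of $\mathbb{R}^d$; $\langle\cdot,\cdot\rangle$ is the standard inner product; $\|x\|_{l_1^d}=\sum_{i=1}^d|x_i|$. The sign of a vector is taken entrywise: $\mathrm{sign}(x)=(\mathrm{sign}(x_i))_i$, with $\mathrm{sign}(0)=0$. $\|f-\hat f\|_\infty=\sup_{x\in[-1,1]^d}|f(x)-\hat f(x)|$. *)

theory Defs
  imports "HOL-Analysis.Analysis"
begin

definition l1_norm :: "real ^ 'd \<Rightarrow> real" where
  "l1_norm x = (\<Sum>i\<in>UNIV. \<bar>x $ i\<bar>)"

text \<open>The entrywise sign. The library's \<open>sgn\<close> on \<open>real ^ 'd\<close> is a different
  function: it normalises a vector to Euclidean length one.\<close>

definition sign_vec :: "real ^ 'd \<Rightarrow> real ^ 'd" where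
  "sign_vec x = (\<chi> i. sgn (x $ i))"

text \<open>The cube \<open>[-1, 1]^d\<close> is \<open>cbox (- 1) 1\<close>, where \<open>1\<close> is the all-ones vector.
  Functions on the cube (and on \<open>[-1, 1]\<close>) are total functions of which only the values
  there matter. The supremum is taken in the extended reals, so it is \<open>\<infinity>\<close>, and
  not an arbitrary real, for an unbounded difference.\<close>

definition sup_norm_cube :: "(real ^ 'd \<Rightarrow> real) \<Rightarrow> ereal" where
  "sup_norm_cube u = (SUP x\<in>cbox (- 1) 1. ereal \<bar>u x\<bar>)"

definition a_tilde :: "(real ^ 'd \<Rightarrow> real) \<Rightarrow> real \<Rightarrow> real ^ 'd" where
  "a_tilde f h = (\<chi> i. (f (h *\<^sub>R axis i 1) - f 0) / h)"

text \<open>Only meaningful if \<open>a_tilde f h \<noteq> 0\<close>.\<close>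

definition a_hat :: "(real ^ 'd \<Rightarrow> real) \<Rightarrow> real \<Rightarrow> real ^ 'd" where
  "a_hat f h = a_tilde f h /\<^sub>R l1_norm (a_tilde f h)"

definition g_hat :: "(real ^ 'd \<Rightarrow> real) \<Rightarrow> real \<Rightarrow> real \<Rightarrow> real" where
  "g_hat f h t = f (t *\<^sub>R sign_vec (a_hat f h))"

definition f_hat :: "(real ^ 'd \<Rightarrow> real) \<Rightarrow> real \<Rightarrow> real ^ 'd \<Rightarrow> real" where
  "f_hat f h x = g_hat f h (a_hat f h \<bullet> x)"

end

theory Submission
  imports Defs
begin

text \<open>Both estimates are elementary consequences of the duality between the \<open>l\<^sub>1\<close> norm and the
  cube: \<open>\<bar>v \<bullet> x\<bar>\<close> is at most the \<open>l\<^sub>1\<close> norm of \<open>v\<close> when \<open>x\<close> lies in the cube.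

  For the first estimate, the point \<open>s = sign_vec (a_hat f h)\<close> of the cube satisfies
  \<open>a_hat f h \<bullet> s = 1\<close>. With \<open>t = a_hat f h \<bullet> x\<close>, the approximation at \<open>x\<close> is \<open>g\<close>
  evaluated at \<open>t * (a \<bullet> s)\<close>, whereas \<open>f x\<close> is \<open>g\<close> evaluated at \<open>a \<bullet> x\<close>. Passing from
  \<open>a \<bullet> x\<close> to \<open>t\<close>, and from \<open>t = t * (a_hat f h \<bullet> s)\<close> to \<open>t * (a \<bullet> s)\<close>, moves the argument
  each time by at most the \<open>l\<^sub>1\<close> norm of \<open>a_hat f h - a\<close>; the Lipschitz bound on \<open>g\<close> does the
  rest (\<open>ridge_recovery_error\<close>).

  For the second estimate, the difference quotient \<open>a_tilde f h\<close> differs from \<open>g' 0 *\<^sub>R a\<close>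
  in the \<open>i\<close>-th entry by at most \<open>c1 * h * (a $ i)\<^sup>2 \<le> c1 * h * \<bar>a $ i\<bar>\<close>, by a first-order Taylor
  bound (\<open>linearisation_error\<close>). Summing, the \<open>l\<^sub>1\<close> distance is at most \<open>c1 * h\<close>. As
  \<open>g' 0 *\<^sub>R a\<close> has norm \<open>g' 0\<close>, normalising loses only a factor of 2 and a division by the norm of
  \<open>a_tilde f h\<close>, which is at least \<open>g' 0 - c1 * h\<close> (\<open>l1_norm_normalize_error\<close>).\<close>

lemma l1_norm_nonneg: "l1_norm x \<ge> 0"
  by (simp add: l1_norm_def sum_nonneg)

lemma l1_norm_zero_iff: "l1_norm x = 0 \<longleftrightarrow> x = 0"
  by (simp add: l1_norm_def sum_nonneg_eq_0_iff vec_eq_iff)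

lemma l1_norm_scaleR: "l1_norm (c *\<^sub>R x) = \<bar>c\<bar> * l1_norm x"
  by (simp add: l1_norm_def abs_mult sum_distrib_left)

lemma l1_norm_triangle: "l1_norm (x + y) \<le> l1_norm x + l1_norm y"
  unfolding l1_norm_def sum.distrib[symmetric] by (intro sum_mono) (simp add: abs_triangle_ineq)

lemma l1_norm_minus_commute: "l1_norm (x - y) = l1_norm (y - x)"
  by (simp add: l1_norm_def abs_minus_commute)

lemma l1_norm_normalize: "x \<noteq> 0 \<Longrightarrow> l1_norm (x /\<^sub>R l1_norm x) = 1"
  using l1_norm_nonneg[of x] by (simp add: l1_norm_scaleR l1_norm_zero_iff)

lemma mem_unit_cube_iff: "x \<in> cbox (- 1) 1 \<longleftrightarrow> (\<forall>i. \<bar>(x :: real ^ 'd) $ i\<bar> \<le> 1)"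
  by (auto simp: mem_box_cart abs_le_iff minus_le_iff)

lemma scaleR_mem_unit_cube:
  assumes "\<bar>t\<bar> \<le> 1" "x \<in> cbox (- 1) (1 :: real ^ 'd)"
  shows "t *\<^sub>R x \<in> cbox (- 1) 1"
  using assms by (auto simp: mem_unit_cube_iff abs_mult mult_le_one)

lemma sign_vec_mem_unit_cube: "sign_vec x \<in> cbox (- 1) 1"
  by (simp add: mem_unit_cube_iff sign_vec_def sgn_real_def)

lemma inner_sign_vec: "x \<bullet> sign_vec x = l1_norm x"
  by (simp add: inner_vec_def sign_vec_def l1_norm_def abs_sgn)

lemma abs_inner_le_l1_norm:
  assumes "x \<in> cbox (- 1) (1 :: real ^ 'd)"
  shows "\<bar>v \<bullet> x\<bar> \<le> l1_norm v"
proof -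
  have "\<bar>v \<bullet> x\<bar> \<le> (\<Sum>i\<in>UNIV. \<bar>v $ i * x $ i\<bar>)"
    by (simp add: inner_vec_def)
  also have "\<dots> \<le> l1_norm v"
    unfolding l1_norm_def using assms
    by (intro sum_mono) (simp add: abs_mult mem_unit_cube_iff mult_left_le)
  finally show ?thesis .
qed

text \<open>Dividing by the norm of \<open>v\<close> instead of by \<open>m\<close> causes a second error of the same size, because
  \<open>m\<close>, the norm of \<open>m *\<^sub>R a\<close>, is within the original error \<open>e\<close> of the norm of \<open>v\<close>.\<close>

lemma l1_norm_normalize_error:
  fixes a v :: "real ^ 'd"
  assumes a: "l1_norm a = 1" and err: "l1_norm (v - m *\<^sub>R a) \<le> e" and e: "e < m"
  shows "v \<noteq> 0" and "l1_norm (v /\<^sub>R l1_norm v - a) \<le> 2 * e / (m - e)"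
proof -
  let ?n = "l1_norm v"
  have "0 \<le> e"
    using err l1_norm_nonneg order_trans by blast
  then have m: "l1_norm (m *\<^sub>R a) = m"
    using a e by (simp add: l1_norm_scaleR)
  have lower: "m - e \<le> ?n"
    using l1_norm_triangle[of "m *\<^sub>R a - v" v] err m by (simp add: l1_norm_minus_commute[of _ v])
  have upper: "?n \<le> m + e"
    using l1_norm_triangle[of "v - m *\<^sub>R a" "m *\<^sub>R a"] err m by simp
  have pos: "0 < ?n"
    using lower e by linarith
  then show "v \<noteq> 0"
    using l1_norm_zero_iff[of v] by auto
  have "l1_norm (v - ?n *\<^sub>R a) \<le> l1_norm (v - m *\<^sub>R a) + l1_norm ((m - ?n) *\<^sub>R a)"
    using l1_norm_triangle[of "v - m *\<^sub>R a" "(m - ?n) *\<^sub>R a"] by (simp add: algebra_simps)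
  also have "\<dots> \<le> 2 * e"
    using err lower upper a by (simp add: l1_norm_scaleR)
  finally have num: "l1_norm (v - ?n *\<^sub>R a) \<le> 2 * e" .
  have "v /\<^sub>R ?n - a = inverse ?n *\<^sub>R (v - ?n *\<^sub>R a)"
    using pos by (simp add: scaleR_right_diff_distrib)
  then have "l1_norm (v /\<^sub>R ?n - a) = l1_norm (v - ?n *\<^sub>R a) / ?n"
    using pos by (simp only: l1_norm_scaleR) (simp add: divide_inverse)
  also have "\<dots> \<le> 2 * e / (m - e)"
    using num lower e \<open>0 \<le> e\<close> by (intro frac_le) auto
  finally show "l1_norm (v /\<^sub>R ?n - a) \<le> 2 * e / (m - e)" .
qed

text \<open>The mean value inequality for \<open>\<lambda>t. g t - g' 0 * t\<close> on \<open>[-\<bar>s\<bar>, \<bar>s\<bar>]\<close>, where its derivative is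
  at most \<open>c * \<bar>s\<bar>\<close> in absolute value.\<close>

lemma linearisation_error:
  fixes g g' :: "real \<Rightarrow> real"
  assumes deriv: "\<And>t. t \<in> {-1..1} \<Longrightarrow> (g has_real_derivative g' t) (at t within {-1..1})"
    and lip: "\<And>t. t \<in> {-1..1} \<Longrightarrow> \<bar>g' t - g' 0\<bar> \<le> c * \<bar>t\<bar>"
    and c: "0 \<le> c" and s: "\<bar>s\<bar> \<le> 1"
  shows "\<bar>g s - g 0 - g' 0 * s\<bar> \<le> c * s\<^sup>2"
proof -
  let ?I = "{-\<bar>s\<bar>..\<bar>s\<bar>}"
  have "norm ((g s - g' 0 * s) - (g 0 - g' 0 * 0)) \<le> (c * \<bar>s\<bar>) * norm (s - 0)"
  proof (rule field_differentiable_bound[where S = ?I and f' = "\<lambda>t. g' t - g' 0"])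
    fix t assume t: "t \<in> ?I"
    then have t1: "t \<in> {-1..1}"
      using s by auto
    have "(g has_real_derivative g' t) (at t within ?I)"
      using s by (intro DERIV_subset[OF deriv[OF t1]]) auto
    then show "((\<lambda>t. g t - g' 0 * t) has_real_derivative g' t - g' 0) (at t within ?I)"
      by (auto intro!: derivative_eq_intros)
    have "c * \<bar>t\<bar> \<le> c * \<bar>s\<bar>"
      using t c by (intro mult_left_mono) auto
    then show "norm (g' t - g' 0) \<le> c * \<bar>s\<bar>"
      using lip[OF t1] by simp
  qed auto
  then show ?thesis
    by (simp add: power2_eq_square mult.assoc algebra_simps flip: abs_mult)
qed

text \<open>The approximation to \<open>g (a \<bullet> x)\<close> made with a direction \<open>b\<close> of unit norm: \<open>sign_vec b\<close> is a
  point of the cube at which the functional \<open>b\<close> takes its maximum 1, so that \<open>t *\<^sub>R sign_vec b\<close>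
  represents all points of the cube on which \<open>b\<close> takes the value \<open>t\<close>.\<close>

lemma ridge_recovery_error:
  fixes a b x :: "real ^ 'd"
  assumes a: "l1_norm a = 1" and b: "l1_norm b = 1" and c: "0 \<le> c"
    and lip: "\<And>t1 t2. t1 \<in> {-1..1} \<Longrightarrow> t2 \<in> {-1..1} \<Longrightarrow> \<bar>g t1 - g t2\<bar> \<le> c * \<bar>t1 - t2\<bar>"
    and x: "x \<in> cbox (- 1) 1"
  shows "\<bar>g (a \<bullet> x) - g (a \<bullet> ((b \<bullet> x) *\<^sub>R sign_vec b))\<bar> \<le> 2 * c * l1_norm (b - a)"
proof -
  let ?s = "sign_vec b" and ?t = "b \<bullet> x" and ?D = "l1_norm (b - a)"
  have t: "\<bar>?t\<bar> \<le> 1"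
    using abs_inner_le_l1_norm[OF x, of b] b by simp
  have "?t *\<^sub>R ?s \<in> cbox (- 1) 1"
    by (intro scaleR_mem_unit_cube t sign_vec_mem_unit_cube)
  then have "\<bar>a \<bullet> (?t *\<^sub>R ?s)\<bar> \<le> 1" "\<bar>a \<bullet> x\<bar> \<le> 1"
    using x a abs_inner_le_l1_norm[of _ a] by fastforce+
  then have "\<bar>g (a \<bullet> x) - g (a \<bullet> (?t *\<^sub>R ?s))\<bar> \<le> c * \<bar>a \<bullet> x - a \<bullet> (?t *\<^sub>R ?s)\<bar>"
    by (intro lip) auto
  moreover have "\<bar>a \<bullet> x - a \<bullet> (?t *\<^sub>R ?s)\<bar> \<le> 2 * ?D"
  proof -
    have "a \<bullet> x - a \<bullet> (?t *\<^sub>R ?s) = ?t * ((b - a) \<bullet> ?s) - (b - a) \<bullet> x"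
      by (simp add: inner_diff_left inner_sign_vec b algebra_simps)
    moreover have "\<bar>(b - a) \<bullet> x\<bar> \<le> ?D"
      by (intro abs_inner_le_l1_norm x)
    moreover have "\<bar>?t * ((b - a) \<bullet> ?s)\<bar> \<le> 1 * ?D"
      unfolding abs_mult
      by (intro mult_mono t abs_inner_le_l1_norm sign_vec_mem_unit_cube) auto
    ultimately show ?thesis
      by linarith
  qed
  then have "c * \<bar>a \<bullet> x - a \<bullet> (?t *\<^sub>R ?s)\<bar> \<le> c * (2 * ?D)"
    using c by (rule mult_left_mono)
  ultimately show ?thesis
    by simp
qed

text \<open>The quadratic linearisation error \<open>c1 * (h * a $ i)\<^sup>2 / h\<close> of the \<open>i\<close>-th entry is weakened to
  \<open>c1 * h * \<bar>a $ i\<bar>\<close>, whose sum over \<open>i\<close> is \<open>c1 * h\<close> in any dimension.\<close>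

lemma a_tilde_error:
  fixes a :: "real ^ 'd" and g g' :: "real \<Rightarrow> real"
  assumes a: "l1_norm a = 1"
    and deriv: "\<And>t. t \<in> {-1..1} \<Longrightarrow> (g has_real_derivative g' t) (at t within {-1..1})"
    and lip: "\<And>t. t \<in> {-1..1} \<Longrightarrow> \<bar>g' t - g' 0\<bar> \<le> c * \<bar>t\<bar>"
    and c: "0 \<le> c"
    and f: "\<And>x. x \<in> cbox (- 1) 1 \<Longrightarrow> f x = g (a \<bullet> x)"
    and h: "0 < h" "h \<le> 1"
  shows "l1_norm (a_tilde f h - g' 0 *\<^sub>R a) \<le> c * h"
proof -
  have "\<bar>(a_tilde f h - g' 0 *\<^sub>R a) $ i\<bar> \<le> c * h * \<bar>a $ i\<bar>" for i
  proof -
    have ai: "\<bar>a $ i\<bar> \<le> 1"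
      using a member_le_sum[of i UNIV "\<lambda>i. \<bar>a $ i\<bar>"] by (simp add: l1_norm_def)
    let ?s = "h * a $ i"
    have "h *\<^sub>R axis i 1 \<in> cbox (- 1) (1 :: real ^ 'd)"
      using h by (simp add: mem_unit_cube_iff axis_def)
    then have "f (h *\<^sub>R axis i 1) = g ?s"
      by (simp add: f inner_axis)
    moreover have "f 0 = g 0"
      using f[of 0] by (simp add: mem_unit_cube_iff)
    ultimately have "(a_tilde f h - g' 0 *\<^sub>R a) $ i = (g ?s - g 0 - g' 0 * ?s) / h"
      using h by (simp add: a_tilde_def field_simps)
    moreover have "\<bar>g ?s - g 0 - g' 0 * ?s\<bar> \<le> c * ?s\<^sup>2"
      using h ai by (intro linearisation_error deriv lip c) (auto simp: abs_mult mult_le_one)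
    ultimately have "\<bar>(a_tilde f h - g' 0 *\<^sub>R a) $ i\<bar> \<le> c * ?s\<^sup>2 / h"
      using h by (simp add: divide_right_mono)
    also have "\<dots> = c * h * (\<bar>a $ i\<bar> * \<bar>a $ i\<bar>)"
      using h by (simp add: power2_eq_square)
    also have "\<dots> \<le> c * h * (\<bar>a $ i\<bar> * 1)"
      using h c ai by (intro mult_left_mono) auto
    finally show ?thesis
      by simp
  qed
  then have "l1_norm (a_tilde f h - g' 0 *\<^sub>R a) \<le> (\<Sum>i\<in>UNIV. c * h * \<bar>a $ i\<bar>)"
    unfolding l1_norm_def by (rule sum_mono)
  also have "\<dots> = c * h"
    using a by (simp add: l1_norm_def flip: sum_distrib_left)
  finally show ?thesis .
qed

theorem theorem3p3:
  fixes a :: "real ^ 'd" and c0 c1 h :: real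
    and g g' :: "real \<Rightarrow> real" and f :: "real ^ 'd \<Rightarrow> real"
  assumes a: "l1_norm a = 1"
    and c0: "c0 > 0" and c1: "c1 > 0"
    and g_deriv: "\<And>t. t \<in> {-1..1} \<Longrightarrow> (g has_real_derivative g' t) (at t within {-1..1})"
    and g_lipschitz: "\<And>t1 t2. t1 \<in> {-1..1} \<Longrightarrow> t2 \<in> {-1..1} \<Longrightarrow>
      \<bar>g t1 - g t2\<bar> \<le> c0 * \<bar>t1 - t2\<bar>"
    and g'_lipschitz: "\<And>t1 t2. t1 \<in> {-1..1} \<Longrightarrow> t2 \<in> {-1..1} \<Longrightarrow>
      \<bar>g' t1 - g' t2\<bar> \<le> c1 * \<bar>t1 - t2\<bar>"
    and g'_0: "g' 0 > 0"
    and f: "\<And>x. x \<in> cbox (- 1) 1 \<Longrightarrow> f x = g (a \<bullet> x)"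
    and h: "0 < h" "h \<le> 1"
  shows "(a_tilde f h \<noteq> 0 \<longrightarrow>
      sup_norm_cube (\<lambda>x. f x - f_hat f h x) \<le> ereal (2 * c0 * l1_norm (a_hat f h - a))) \<and>
    (g' 0 - c1 * h > 0 \<longrightarrow>
      a_tilde f h \<noteq> 0 \<and>
      2 * c0 * l1_norm (a_hat f h - a) \<le> 4 * c0 * c1 * h / (g' 0 - c1 * h))"
proof (intro conjI[of "_ \<longrightarrow> _"] impI)
  assume nz: "a_tilde f h \<noteq> 0"
  let ?b = "a_hat f h"
  have b: "l1_norm ?b = 1"
    using l1_norm_normalize[OF nz] by (simp add: a_hat_def)
  have "\<bar>f x - f_hat f h x\<bar> \<le> 2 * c0 * l1_norm (?b - a)" if x: "x \<in> cbox (- 1) 1" for x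
  proof -
    have "\<bar>?b \<bullet> x\<bar> \<le> 1"
      using abs_inner_le_l1_norm[OF x, of ?b] b by simp
    then have "f_hat f h x = g (a \<bullet> ((?b \<bullet> x) *\<^sub>R sign_vec ?b))"
      unfolding f_hat_def g_hat_def by (intro f scaleR_mem_unit_cube sign_vec_mem_unit_cube)
    then show ?thesis
      using ridge_recovery_error[OF a b less_imp_le[OF c0] g_lipschitz x] f[OF x] by simp
  qed
  then show "sup_norm_cube (\<lambda>x. f x - f_hat f h x) \<le> ereal (2 * c0 * l1_norm (?b - a))"
    unfolding sup_norm_cube_def by (intro SUP_least) simp
next
  assume pos: "g' 0 - c1 * h > 0"
  have "l1_norm (a_tilde f h - g' 0 *\<^sub>R a) \<le> c1 * h"
    using g'_lipschitz[of _ 0] c1 by (intro a_tilde_error[OF a g_deriv _ _ f h]) auto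
  note normalized = l1_norm_normalize_error[OF a this]
  show "a_tilde f h \<noteq> 0 \<and> 2 * c0 * l1_norm (a_hat f h - a) \<le> 4 * c0 * c1 * h / (g' 0 - c1 * h)"
  proof
    show "a_tilde f h \<noteq> 0"
      using normalized(1) pos by simp
    have "2 * c0 * l1_norm (a_hat f h - a) \<le> 2 * c0 * (2 * (c1 * h) / (g' 0 - c1 * h))"
      unfolding a_hat_def using normalized(2) pos c0 by (intro mult_left_mono) auto
    then show "2 * c0 * l1_norm (a_hat f h - a) \<le> 4 * c0 * c1 * h / (g' 0 - c1 * h)"
      by (simp add: mult.assoc)
  qed
qed

end
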